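(* For each integer $d \geq 2$, there exists an unbounded $0/1$-polyhedron in $\mathbb{R}^{6d}$ with combinatorial diameter at least $2^{d}-1$ such that every ray of its recession cone (i.e. every extreme ray) has a generator in $\{-1,0,1\}^{6d}$.
   Context: An unbounded $0/1$-polyhedron in $\mathbb{R}^n$ is an unbounded polyhedron (a finite intersection of closed half-spaces) that has vertices and all of whose vertices lie in $\{0,1\}^n$. The graph of a polyhedron has the vertices of the polyhedron as nodes and the bounded edges (bounded 1-dimensional faces, each joining two vertices) as edges. The combinatorial diameter of a polyhedron is the maximum, over all pairs of vertices, of the number of edges in a shortest path between them in this graph. The recession cone of a polyhedron $P$ is $\{\mathbf{r} : \mathbf{x} + \lambda\mathbf{r} \in P \text{ for all } \mathbf{x} \in P,\ \lambda \geq 0\}$; a generator of a ray of this cone is a nonzero vector spanning that ray. *)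

theory Defs
  imports "HOL-Analysis.Analysis" "HOL-Library.Extended_Nat"
begin

definition vertices :: "'a::euclidean_space set \<Rightarrow> 'a set" where
  "vertices P = {v. v extreme_point_of P}"

definition unbounded_01_polyhedron :: "(real ^ 'n) set \<Rightarrow> bool" where
  "unbounded_01_polyhedron P \<longleftrightarrow>
     polyhedron P \<and> \<not> bounded P \<and> vertices P \<noteq> {} \<and>
     (\<forall>v \<in> vertices P. \<forall>i. v $ i \<in> {0, 1})"

text \<open>The edges of the graph, as a symmetric relation on the vertices. The two vertices of a bounded
  edge are distinct, since an edge has affine dimension 1 and a compact convex set is the hull of its
  extreme points.\<close>

definition graph_edges :: "'a::euclidean_space set \<Rightarrow> ('a \<times> 'a) set" where
  "graph_edges P = {(v, w). \<exists>e. e edge_of P \<and> bounded e \<and> vertices e = {v, w}}"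

text \<open>An infimum over walk lengths, hence \<open>\<infinity>\<close> if there is no walk from \<open>v\<close> to \<open>w\<close>.\<close>

definition graph_dist :: "'a::euclidean_space set \<Rightarrow> 'a \<Rightarrow> 'a \<Rightarrow> enat" where
  "graph_dist P v w = (INF k \<in> {k. (v, w) \<in> graph_edges P ^^ k}. enat k)"

text \<open>A polyhedron has finitely many vertices, so for one with a vertex this supremum is a maximum.\<close>

definition combinatorial_diameter :: "'a::euclidean_space set \<Rightarrow> enat" where
  "combinatorial_diameter P = (SUP v \<in> vertices P. SUP w \<in> vertices P. graph_dist P v w)"

definition recession_cone :: "'a::real_vector set \<Rightarrow> 'a set" where
  "recession_cone P = {r. \<forall>x \<in> P. \<forall>l \<ge> 0. x + l *\<^sub>R r \<in> P}"

definition generates_ray :: "'a::real_vector \<Rightarrow> 'a set \<Rightarrow> bool" where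
  "generates_ray g R \<longleftrightarrow> g \<noteq> 0 \<and> R = {t *\<^sub>R g | t. t \<ge> 0}"

text \<open>The extreme rays of a cone are its one-dimensional faces that are half-lines from the origin. If
  a polyhedron has a vertex, its recession cone contains no line, and all edges of the cone are rays.\<close>

definition extreme_ray_of :: "'a::euclidean_space set \<Rightarrow> 'a set \<Rightarrow> bool" where
  "extreme_ray_of R C \<longleftrightarrow> R edge_of C \<and> (\<exists>g. generates_ray g R)"

end

theory Submission
  imports Defs
begin

text \<open>
  Let \<open>N = 2 ^ d\<close>, and encode the points \<open>(k, k\<^sup>2)\<close> of a parabola, \<open>k < N\<close>, as 0/1-vectors \<open>v k\<close>:
  \<open>d\<close> binary digits for \<open>k\<close> and \<open>2 * d\<close> for \<open>k\<^sup>2\<close>. The set of vertices is free to choose, so the digits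
  of \<open>k\<^sup>2\<close> can be treated as coordinates independent of those of \<open>k\<close>, and weights that are powers
  of \<open>2\<close> turn every quadratic function \<open>(k - t)\<^sup>2 - t\<^sup>2 = k\<^sup>2 - 2 * t * k\<close> into a linear functional \<open>c t\<close>
  of the digits. Each digit is written twice, which gives \<open>6 * d\<close> coordinates.

  The polyhedron \<open>P\<close> is the convex hull of the \<open>v k\<close> plus the cone generated by the set \<open>G\<close> of all
  vectors with entries in \<open>{-1, 0, 1}\<close> on which \<open>c 0\<close> and \<open>c (N - 1)\<close> are both positive. Every extreme
  ray of the recession cone is then spanned by an element of \<open>G\<close>, and every vertex is some \<open>v k\<close>.
  As \<open>c 0\<close> and \<open>c (N - 1)\<close> have their unique minima at \<open>v 0\<close> and \<open>v (N - 1)\<close>, these two are vertices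
  (\<open>unique_minimizer_extreme_point\<close>).

  The cone is large enough to destroy all shortcuts. For \<open>j + 2 \<le> k\<close> consider
  \<open>r = v j + v k - v (j + 1) - v (k - 1)\<close>. Convexity of the square makes \<open>c t\<close> positive on \<open>r\<close> for
  every \<open>t\<close>. The entries of \<open>r\<close> lie between \<open>-2\<close> and \<open>2\<close>, and because every digit occurs twice, \<open>r\<close>
  is the sum of two vectors with entries in \<open>{-1, 0, 1}\<close> that have the same value under each \<open>c t\<close>
  (\<open>dup_split\<close>): an odd entry goes to one summand in one copy of the digit and to the other
  summand in the other copy. Hence both summands are in \<open>G\<close> and \<open>r\<close> is in the cone. Now \<open>v j\<close> and
  \<open>v k\<close> have the same midpoint as \<open>v (j + 1)\<close> and \<open>v (k - 1) + r\<close>, both in \<open>P\<close>, so a face that contains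
  \<open>v j\<close> and \<open>v k\<close> contains \<open>v (j + 1)\<close>, and cannot be the segment between them
  (\<open>chain_edge_short\<close>). So an edge changes the index by at most \<open>1\<close>, and a walk from \<open>v 0\<close> to
  \<open>v (N - 1)\<close> has at least \<open>N - 1\<close> edges.
\<close>

section \<open>Polyhedra generated by finitely many points and directions\<close>

definition generated_polyhedron :: "'a::euclidean_space set \<Rightarrow> 'a set \<Rightarrow> 'a set" where
  "generated_polyhedron V G = {a + r |a r. a \<in> convex hull V \<and> r \<in> convex_cone hull G}"

lemma generated_polyhedron_add:
  assumes "x \<in> generated_polyhedron V G" "r \<in> convex_cone hull G"
  shows "x + r \<in> generated_polyhedron V G"
  using assms unfolding generated_polyhedron_def
  by (smt (verit, best) add.assoc convex_cone_hull_add mem_Collect_eq)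

lemma convex_hull_subset_generated_polyhedron:
  "convex hull V \<subseteq> generated_polyhedron V G"
  unfolding generated_polyhedron_def using convex_cone_hull_contains_0 by force

lemma generated_polyhedron_hull_inc: "v \<in> V \<Longrightarrow> v \<in> generated_polyhedron V G"
  using convex_hull_subset_generated_polyhedron hull_inc by (metis subsetD)

lemma polyhedron_vertical_slice:
  fixes K :: "('a::euclidean_space \<times> real) set"
  assumes "polyhedron K"
  shows "polyhedron {x. (x, t) \<in> K}"
proof -
  obtain F where F: "finite F" "K = \<Inter> F"
    and half: "\<forall>h\<in>F. \<exists>a b. a \<noteq> 0 \<and> h = {x. a \<bullet> x \<le> b}"
    using assms unfolding polyhedron_def by (elim exE conjE)
  have "polyhedron {x. (x, t) \<in> h}" if "h \<in> F" for h
  proof -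
    obtain a b where h: "h = {x. a \<bullet> x \<le> b}" using half \<open>h \<in> F\<close> by auto
    have "{x. (x, t) \<in> h} = {x. fst a \<bullet> x \<le> b - snd a * t}"
      unfolding h by (auto simp: inner_prod_def algebra_simps)
    then show ?thesis by (simp add: polyhedron_halfspace_le)
  qed
  then have "polyhedron (\<Inter>h\<in>F. {x. (x, t) \<in> h})"
    using F(1) by (intro polyhedron_Inter) auto
  moreover have "(\<Inter>h\<in>F. {x. (x, t) \<in> h}) = {x. (x, t) \<in> K}"
    unfolding F(2) by auto
  ultimately show ?thesis by simp
qed

text \<open>Homogenization: the sum of hull and cone is the slice at height \<open>1\<close> of the finitely generated cone
  over \<open>V\<close> at height \<open>1\<close> and \<open>G\<close> at height \<open>0\<close>, and finitely generated cones are polyhedra.\<close>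

lemma polyhedron_generated_polyhedron:
  fixes V G :: "'a::euclidean_space set"
  assumes "finite V" "finite G"
  shows "polyhedron (generated_polyhedron V G)"
proof (cases "V = {}")
  case True
  then show ?thesis by (simp add: generated_polyhedron_def)
next
  case False
  define K where "K = convex_cone hull (V \<times> {1::real} \<union> G \<times> {0})"
  have V1: "convex_cone hull (V \<times> {1::real}) = {(c *\<^sub>R a, c) |c a. a \<in> convex hull V \<and> 0 \<le> c}"
    using False by (force simp: convex_cone_hull_convex_hull_nonempty convex_hull_Times)
  have "G \<times> {0::real} = (\<lambda>x. (x, 0)) ` G" by auto
  moreover have "linear (\<lambda>x::'a. (x, 0::real))" by (auto intro!: linearI)
  ultimately have G0: "convex_cone hull (G \<times> {0::real}) = (\<lambda>x. (x, 0)) ` (convex_cone hull G)"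
    by (simp add: convex_cone_hull_linear_image)
  have "generated_polyhedron V G = {x. (x, 1) \<in> K}"
    unfolding K_def convex_cone_hull_Un V1 G0 generated_polyhedron_def by force
  moreover have "polyhedron K"
    unfolding K_def using assms by (intro polyhedron_convex_cone_hull) auto
  ultimately show ?thesis by (simp add: polyhedron_vertical_slice)
qed

lemma unbounded_generated_polyhedron:
  assumes "V \<noteq> {}" "r \<in> convex_cone hull G" "r \<noteq> 0"
  shows "\<not> bounded (generated_polyhedron V G)"
proof
  assume "bounded (generated_polyhedron V G)"
  then obtain B where B: "\<And>x. x \<in> generated_polyhedron V G \<Longrightarrow> norm x \<le> B"
    unfolding bounded_iff by blast
  obtain v where v: "v \<in> V" using assms(1) by blast
  define l where "l = (B + norm v + 1) / norm r"
  have "norm v \<le> B" by (simp add: B generated_polyhedron_hull_inc v)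
  then have "0 \<le> B + norm v + 1" using norm_ge_zero[of v] by linarith
  then have l: "l \<ge> 0" by (simp add: l_def)
  have "norm (v + l *\<^sub>R r) \<le> B"
    using assms(2) l v by (intro B generated_polyhedron_add generated_polyhedron_hull_inc convex_cone_hull_mul)
  moreover have "norm (l *\<^sub>R r) = B + norm v + 1"
    using \<open>0 \<le> B + norm v + 1\<close> assms(3) by (simp add: l_def)
  moreover have "norm (l *\<^sub>R r) \<le> norm (v + l *\<^sub>R r) + norm v"
    using norm_triangle_ineq4[of "v + l *\<^sub>R r" v] by simp
  ultimately show False by linarith
qed

text \<open>A point \<open>a + r\<close> with \<open>r \<noteq> 0\<close> in the cone is the midpoint of \<open>a\<close> and \<open>a + 2 *\<^sub>R r\<close>, so an extreme
  point of the sum is already one of the convex hull.\<close>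

lemma extreme_point_of_generated_polyhedron:
  assumes "x extreme_point_of generated_polyhedron V G"
  shows "x \<in> V"
proof -
  obtain a r where a: "a \<in> convex hull V" and r: "r \<in> convex_cone hull G" and x: "x = a + r"
    using assms unfolding extreme_point_of_def generated_polyhedron_def by blast
  have aP: "a \<in> generated_polyhedron V G"
    using a convex_hull_subset_generated_polyhedron by blast
  have "r = 0"
  proof (rule ccontr)
    assume "r \<noteq> 0"
    have "2 *\<^sub>R r \<in> convex_cone hull G" using r by (simp add: convex_cone_hull_mul)
    then have "a + 2 *\<^sub>R r \<in> generated_polyhedron V G" using aP by (rule generated_polyhedron_add[rotated])
    moreover have "x = midpoint a (a + 2 *\<^sub>R r)"
      by (simp add: x midpoint_def scaleR_right_distrib flip: scaleR_left_distrib)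
    then have "x \<in> open_segment a (a + 2 *\<^sub>R r)"
      using \<open>r \<noteq> 0\<close> by simp
    ultimately show False using assms aP unfolding extreme_point_of_def by blast
  qed
  then have "x \<in> convex hull V" using a x by simp
  then have "x extreme_point_of (convex hull V)"
    using assms convex_hull_subset_generated_polyhedron[of V G] unfolding extreme_point_of_def by blast
  then show ?thesis by (rule extreme_point_of_convex_hull)
qed

lemma convex_cone_open_halfspace_insert_0: "convex_cone {x. x = 0 \<or> c \<bullet> x > 0}"
  unfolding convex_cone_iff
  by (auto simp: inner_add_right intro: add_pos_pos mult_pos_pos)

text \<open>Both the cone over \<open>G\<close> and \<open>V\<close> shifted by \<open>- v\<close> lie in the convex cone \<open>D\<close> that consists of the open
  halfspace \<open>c > 0\<close> and \<open>0\<close>. So the whole polyhedron lies in \<open>v + D\<close>, which the hyperplane of level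
  \<open>c \<bullet> v\<close> meets only in \<open>v\<close>.\<close>

lemma unique_minimizer_extreme_point:
  assumes "v \<in> V"
    and minV: "\<And>w. w \<in> V \<Longrightarrow> w \<noteq> v \<Longrightarrow> c \<bullet> v < c \<bullet> w"
    and posG: "\<And>g. g \<in> G \<Longrightarrow> 0 < c \<bullet> g"
    and conv: "convex (generated_polyhedron V G)"
  shows "v extreme_point_of generated_polyhedron V G"
proof -
  define D where "D = {x. x = 0 \<or> c \<bullet> x > 0}"
  have D: "convex_cone D" unfolding D_def by (rule convex_cone_open_halfspace_insert_0)
  have G: "convex_cone hull G \<subseteq> D"
    by (rule hull_minimal) (auto simp: D_def posG D[unfolded D_def])
  have "convex ((+) v ` D)" using D by (simp add: convex_cone_def convex_translation)
  moreover have "V \<subseteq> (+) v ` D"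
  proof
    fix w assume "w \<in> V"
    then have "w - v \<in> D" using minV[of w] by (auto simp: D_def inner_diff_right)
    then show "w \<in> (+) v ` D" by (metis add.commute diff_add_cancel image_eqI)
  qed
  ultimately have V: "convex hull V \<subseteq> (+) v ` D" by (simp add: hull_minimal)
  have P: "x - v \<in> D" if x: "x \<in> generated_polyhedron V G" for x
  proof -
    obtain a r where "x = a + r" "a - v \<in> D" "r \<in> D"
      using x V G unfolding generated_polyhedron_def by fastforce
    then show ?thesis using D by (metis add_diff_eq add.commute convex_cone_add)
  qed
  have "generated_polyhedron V G \<inter> {x. c \<bullet> x = c \<bullet> v} face_of generated_polyhedron V G"
    using P by (intro face_of_Int_supporting_hyperplane_ge conv) (force simp: D_def inner_diff_right)
  moreover have "generated_polyhedron V G \<inter> {x. c \<bullet> x = c \<bullet> v} = {v}"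
    using P generated_polyhedron_hull_inc[OF assms(1)] by (force simp: D_def inner_diff_right)
  ultimately show ?thesis by (simp add: face_of_singleton)
qed

text \<open>If \<open>r\<close> is a recession direction, write \<open>v + n *\<^sub>R r\<close> as a point of the bounded hull plus a point of
  the cone. After division by \<open>n\<close> the first part vanishes in the limit, so \<open>r\<close> is a limit of points of
  the cone, which is closed.\<close>

lemma recession_cone_generated_polyhedron:
  fixes V G :: "'a::euclidean_space set"
  assumes "finite V" "V \<noteq> {}" "finite G"
  shows "recession_cone (generated_polyhedron V G) = convex_cone hull G"
proof
  show "convex_cone hull G \<subseteq> recession_cone (generated_polyhedron V G)"
    unfolding recession_cone_def by (auto intro: generated_polyhedron_add convex_cone_hull_mul)
next
  show "recession_cone (generated_polyhedron V G) \<subseteq> convex_cone hull G"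
  proof
    fix r assume r: "r \<in> recession_cone (generated_polyhedron V G)"
    obtain v where v: "v \<in> V" using assms(2) by blast
    have "v + real (Suc n) *\<^sub>R r \<in> generated_polyhedron V G" for n
      using r generated_polyhedron_hull_inc[OF v] unfolding recession_cone_def by simp
    then have "\<exists>a c. v + real (Suc n) *\<^sub>R r = a + c \<and> a \<in> convex hull V \<and> c \<in> convex_cone hull G" for n
      unfolding generated_polyhedron_def by blast
    then obtain a c where ac: "\<And>n. v + real (Suc n) *\<^sub>R r = a n + c n"
      and a: "\<And>n. a n \<in> convex hull V" and c: "\<And>n. c n \<in> convex_cone hull G"
      by metis
    have "bounded (convex hull V)" using assms(1) by (simp add: bounded_convex_hull finite_imp_bounded)
    then obtain B where B: "\<And>x. x \<in> convex hull V \<Longrightarrow> norm x \<le> B" unfolding bounded_iff by blast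
    define e where "e n = inverse (real (Suc n)) *\<^sub>R (v - a n)" for n
    have "norm (e n) \<le> inverse (real (Suc n)) * (B + B)" for n
    proof -
      have "norm (v - a n) \<le> B + B"
        using B[OF a, of n] B[OF hull_inc[OF v]] norm_triangle_ineq4[of v "a n"] by linarith
      then show ?thesis unfolding e_def by (simp add: mult_left_mono del: of_nat_Suc)
    qed
    moreover have "(\<lambda>n. inverse (real (Suc n)) * (B + B)) \<longlonglongrightarrow> 0 * (B + B)"
      by (intro tendsto_mult LIMSEQ_inverse_real_of_nat tendsto_const)
    ultimately have "e \<longlonglongrightarrow> 0"
      by (intro Lim_null_comparison[where f=e]) auto
    then have lim: "(\<lambda>n. r + e n) \<longlonglongrightarrow> r" using tendsto_add[OF tendsto_const, of e 0 _ r] by simp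
    have "r + e n = inverse (real (Suc n)) *\<^sub>R c n" for n
    proof -
      have "c n = real (Suc n) *\<^sub>R r + (v - a n)" using ac[of n] by (simp add: algebra_simps)
      then show ?thesis by (simp add: e_def scaleR_right_distrib del: of_nat_Suc)
    qed
    then have "r + e n \<in> convex_cone hull G" for n
      using c by (simp add: convex_cone_hull_mul del: of_nat_Suc)
    then show "r \<in> convex_cone hull G"
      by (rule closed_sequentially[OF closed_convex_cone_hull[OF assms(3)] _ lim])
  qed
qed

text \<open>What remains of a convex cone when one removes a face that is a ray is again a convex cone once
  \<open>0\<close> is put back. If \<open>G\<close> had no nonzero element on the ray, that smaller cone would contain \<open>G\<close> and
  hence everything, the ray included.\<close>

lemma extreme_ray_of_convex_cone_hull:
  fixes G :: "'a::euclidean_space set"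
  assumes "extreme_ray_of R (convex_cone hull G)"
  shows "\<exists>g\<in>G. generates_ray g R"
proof -
  obtain u where u: "u \<noteq> 0" and R: "R = {t *\<^sub>R u | t. t \<ge> 0}"
    and face: "R face_of convex_cone hull G"
    using assms unfolding extreme_ray_of_def generates_ray_def edge_of_def by blast
  have sub: "R \<subseteq> convex_cone hull G" using face by (rule face_of_imp_subset)
  have scale: "s *\<^sub>R x \<in> R" if x: "x \<in> R" and s: "s \<ge> 0" for x s
  proof -
    obtain t where "x = t *\<^sub>R u" "t \<ge> 0" using x unfolding R by blast
    then show ?thesis using s unfolding R by (auto intro!: exI[of _ "s * t"])
  qed
  have "\<exists>g\<in>G. g \<in> R \<and> g \<noteq> 0"
  proof (rule ccontr)
    assume no: "\<not> ?thesis"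
    define D where "D = insert 0 (convex_cone hull G - R)"
    have "convex_cone D"
      unfolding convex_cone_iff
    proof (intro conjI ballI allI impI)
      fix x y assume x: "x \<in> D" and y: "y \<in> D"
      show "x + y \<in> D"
      proof (cases "x = 0 \<or> y = 0")
        case True
        then show ?thesis using x y by auto
      next
        case False
        then have xC: "x \<in> convex_cone hull G" "x \<notin> R" and yC: "y \<in> convex_cone hull G" "y \<notin> R"
          using x y unfolding D_def by auto
        have "x + y \<notin> R"
        proof
          assume "x + y \<in> R"
          then have m: "midpoint x y \<in> R" unfolding midpoint_def by (rule scale) simp
          then have "x \<noteq> y" using xC by auto
          then have "midpoint x y \<in> open_segment x y" by simp
          then show False using face xC yC m unfolding face_of_def by blast
        qed
        then show ?thesis using xC yC by (simp add: D_def convex_cone_hull_add)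
      qed
    next
      fix x and s :: real assume x: "x \<in> D" and s: "s \<ge> 0"
      show "s *\<^sub>R x \<in> D"
      proof (cases "x = 0 \<or> s = 0")
        case True
        then show ?thesis unfolding D_def by auto
      next
        case False
        then have xC: "x \<in> convex_cone hull G" "x \<notin> R" using x unfolding D_def by auto
        have "s *\<^sub>R x \<notin> R" using scale[of "s *\<^sub>R x" "inverse s"] False s xC by auto
        then show ?thesis using xC s by (simp add: D_def convex_cone_hull_mul)
      qed
    qed (simp add: D_def)
    moreover have "G \<subseteq> D" using no by (auto simp: D_def hull_inc)
    ultimately have "convex_cone hull G \<subseteq> D" by (simp add: hull_minimal)
    moreover have "u \<in> R" unfolding R by (rule CollectI, rule exI[of _ 1]) simp
    ultimately show False using sub u unfolding D_def by blast
  qed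
  then obtain g t where g: "g \<in> G" "g \<noteq> 0" "g = t *\<^sub>R u" "t \<ge> 0" unfolding R by blast
  then have t: "t > 0" by (metis less_eq_real_def scale_zero_left)
  have "R = {s *\<^sub>R g | s. s \<ge> 0}"
  proof
    show "R \<subseteq> {s *\<^sub>R g | s. s \<ge> 0}"
    proof
      fix x assume "x \<in> R"
      then obtain s where "x = s *\<^sub>R u" "s \<ge> 0" unfolding R by blast
      then have "x = (s / t) *\<^sub>R g \<and> s / t \<ge> 0" using t g by simp
      then show "x \<in> {s *\<^sub>R g | s. s \<ge> 0}" by blast
    qed
    show "{s *\<^sub>R g | s. s \<ge> 0} \<subseteq> R" using g scale unfolding R by auto
  qed
  then show ?thesis using g unfolding generates_ray_def by blast
qed

section \<open>Chains of 0/1-points\<close>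

lemma zero_one_vector_in_segment:
  fixes x y z :: "real ^ 'n"
  assumes "\<And>i. x $ i \<in> {0, 1}" "\<And>i. y $ i \<in> {0, 1}" "\<And>i. z $ i \<in> {0, 1}"
    and "z \<in> closed_segment x y"
  shows "z = x \<or> z = y"
proof (rule ccontr)
  assume no: "\<not> ?thesis"
  obtain u where z: "z = (1 - u) *\<^sub>R x + u *\<^sub>R y"
    using assms(4) unfolding closed_segment_def by blast
  have u: "u \<noteq> 0" "u \<noteq> 1" using no z by auto
  have "x $ i = y $ i" for i
  proof -
    have "z $ i = (1 - u) * x $ i + u * y $ i" using z by simp
    then show ?thesis using assms(1-3)[of i] u by auto
  qed
  then have "x = y" by (simp add: vec_eq_iff)
  then show False using no z by (simp add: algebra_simps)
qed

text \<open>The convexity hypothesis lets the midpoint of \<open>v j\<close> and \<open>v k\<close> be written as the midpoint of two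
  other points of the polyhedron, one of which is \<open>v (j + 1)\<close>. A face through \<open>v j\<close> and \<open>v k\<close> therefore
  contains a third 0/1-point, which the segment between two 0/1-points does not.\<close>

lemma chain_edge_short:
  fixes v :: "nat \<Rightarrow> real ^ 'n"
  assumes P: "polyhedron (generated_polyhedron V G)"
    and V: "v ` {..<N} \<subseteq> V"
    and inj: "inj_on v {..<N}"
    and bin: "\<And>k i. k < N \<Longrightarrow> v k $ i \<in> {0, 1}"
    and conv: "\<And>j k. k < N \<Longrightarrow> j + 2 \<le> k \<Longrightarrow>
      v j + v k - v (j + 1) - v (k - 1) \<in> convex_cone hull G"
    and edge: "(v j, v k) \<in> graph_edges (generated_polyhedron V G)"
    and jk: "j < N" "k < N"
  shows "k \<le> j + 1"
proof (rule ccontr)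
  assume "\<not> ?thesis"
  then have k: "j + 2 \<le> k" by simp
  let ?P = "generated_polyhedron V G"
  obtain e where "e edge_of ?P" "bounded e" and ve: "vertices e = {v j, v k}"
    using edge unfolding graph_edges_def by blast
  then have face: "e face_of ?P" by (simp add: edge_of_def)
  have "compact e" "convex e"
    using \<open>bounded e\<close> face P
    by (auto simp: compact_eq_bounded_closed face_of_imp_convex
        intro: face_of_imp_closed polyhedron_imp_convex polyhedron_imp_closed)
  then have e: "e = closed_segment (v j) (v k)"
    using Krein_Milman_Minkowski[of e] ve by (simp add: vertices_def segment_convex_hull)
  define r where "r = v j + v k - v (j + 1) - v (k - 1)"
  have r: "r \<in> convex_cone hull G" using conv jk k by (simp add: r_def)
  have "v (j + 1) \<in> V" "v (k - 1) \<in> V" using V jk k by auto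
  then have inP: "v (j + 1) \<in> ?P" "v (k - 1) + r \<in> ?P"
    using r by (simp_all add: generated_polyhedron_add generated_polyhedron_hull_inc)
  have "midpoint (v (j + 1)) (v (k - 1) + r) = midpoint (v j) (v k)"
    by (simp add: midpoint_def r_def)
  then have mid: "midpoint (v (j + 1)) (v (k - 1) + r) \<in> e"
    by (simp add: e midpoints_in_convex_hull midpoint_in_closed_segment)
  have "v (j + 1) \<in> e"
  proof (cases "v (j + 1) = v (k - 1) + r")
    case True
    then show ?thesis using mid by simp
  next
    case False
    then have "midpoint (v (j + 1)) (v (k - 1) + r) \<in> open_segment (v (j + 1)) (v (k - 1) + r)"
      by simp
    then show ?thesis using face mid inP unfolding face_of_def by blast
  qed
  then have "v (j + 1) = v j \<or> v (j + 1) = v k"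
    using bin jk k unfolding e by (intro zero_one_vector_in_segment) auto
  then show False using jk k inj_onD[OF inj, of "j + 1" j] inj_onD[OF inj, of "j + 1" k] by auto
qed

text \<open>Along a walk the index grows by at most \<open>1\<close> per edge, so a walk that starts at \<open>v 0\<close>
  needs \<open>m\<close> edges to reach \<open>v m\<close>.\<close>

lemma graph_dist_chain_ge:
  assumes inj: "inj_on v {..<N}"
    and verts: "vertices P \<subseteq> v ` {..<N}"
    and short: "\<And>j k. j < N \<Longrightarrow> k < N \<Longrightarrow> (v j, v k) \<in> graph_edges P \<Longrightarrow> k \<le> j + 1"
    and m: "m < N"
  shows "graph_dist P (v 0) (v m) \<ge> enat m"
proof -
  have vert: "y \<in> vertices P" if xy: "(x, y) \<in> graph_edges P" for x y
  proof -
    obtain e where "e face_of P" "y \<in> vertices e"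
      using xy unfolding graph_edges_def edge_of_def by blast
    then show ?thesis by (simp add: vertices_def extreme_point_of_face)
  qed
  have walk: "\<exists>i<N. i \<le> k \<and> w = v i" if "(v 0, w) \<in> graph_edges P ^^ k" for k w
    using that
  proof (induction k arbitrary: w)
    case 0
    then show ?case using m by auto
  next
    case (Suc k)
    then obtain u where u: "(v 0, u) \<in> graph_edges P ^^ k" and uw: "(u, w) \<in> graph_edges P"
      by auto
    obtain i where i: "i < N" "i \<le> k" "u = v i" using Suc.IH[OF u] by blast
    obtain j where j: "j < N" "w = v j" using vert[OF uw] verts by blast
    then have "j \<le> i + 1" using short i uw by blast
    then show ?case using i j by auto
  qed
  have "m \<le> k" if "(v 0, v m) \<in> graph_edges P ^^ k" for k
    using walk[OF that] inj m by (auto simp: inj_on_def)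
  then show ?thesis unfolding graph_dist_def by (auto intro!: INF_greatest)
qed

section \<open>Duplicated coordinates\<close>

text \<open>The coordinates are labelled by \<open>\<phi>\<close> with a digit \<open>q < M\<close> and a Boolean that tells its two copies
  apart.\<close>

locale duplicated_coordinates =
  fixes \<phi> :: "'n::finite \<Rightarrow> bool \<times> nat" and M :: nat
  assumes bij: "bij_betw \<phi> UNIV (UNIV \<times> {..<M})"
begin

definition dup :: "(nat \<Rightarrow> real) \<Rightarrow> real ^ 'n" where
  "dup f = (\<chi> i. f (snd (\<phi> i)))"

lemma dup_nth: "dup f $ i = f (snd (\<phi> i))"
  by (simp add: dup_def)

lemma inner_dup: "dup w \<bullet> (\<chi> i. F (\<phi> i)) = (\<Sum>q<M. w q * (F (True, q) + F (False, q)))"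
proof -
  have "dup w \<bullet> (\<chi> i. F (\<phi> i)) = (\<Sum>i\<in>UNIV. w (snd (\<phi> i)) * F (\<phi> i))"
    by (simp add: inner_vec_def dup_def)
  also have "\<dots> = (\<Sum>p\<in>UNIV \<times> {..<M}. w (snd p) * F p)"
    using bij by (rule sum.reindex_bij_betw)
  also have "\<dots> = (\<Sum>b\<in>UNIV. \<Sum>q<M. w q * F (b, q))"
    by (simp add: sum.cartesian_product case_prod_unfold)
  finally show ?thesis by (simp add: UNIV_bool sum.distrib distrib_left add.commute)
qed

lemma inner_dup_dup: "dup w \<bullet> dup f = 2 * (\<Sum>q<M. w q * f q)"
  using inner_dup[of w "\<lambda>p. f (snd p)"]
  by (simp add: dup_def sum_distrib_left algebra_simps)

text \<open>Even entries are halved. An odd entry, \<open>1\<close> or \<open>-1\<close>, stands in two coordinates of \<open>dup s\<close>; each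
  summand receives it in one of them and \<open>0\<close> in the other. Every symmetric functional \<open>dup w\<close> then
  takes the same value on both summands, so if it is positive on \<open>dup s\<close> it is positive on both.\<close>

lemma dup_split:
  assumes s: "\<And>q. s q \<in> {-2, -1, 0, 1, 2}"
  obtains g h where "dup s = g + h"
    "\<And>i. g $ i \<in> {-1, 0, 1}" "\<And>i. h $ i \<in> {-1, 0, 1}"
    "\<And>w. dup w \<bullet> g = (\<Sum>q<M. w q * s q)" "\<And>w. dup w \<bullet> h = (\<Sum>q<M. w q * s q)"
proof -
  define F where "F c p = (if \<bar>s (snd p)\<bar> = 1 then of_bool (fst p = c) * s (snd p) else s (snd p) / 2)"
    for c :: bool and p
  have sgn: "F c p \<in> {-1, 0, 1}" for c p
    using s[of "snd p"] by (auto simp: F_def)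
  have val: "dup w \<bullet> (\<chi> i. F c (\<phi> i)) = (\<Sum>q<M. w q * s q)" for w c
    unfolding inner_dup by (rule sum.cong) (cases c; simp add: F_def)+
  have "dup s = (\<chi> i. F True (\<phi> i)) + (\<chi> i. F False (\<phi> i))"
    by (auto simp: vec_eq_iff dup_nth F_def)
  then show thesis using that[of "\<chi> i. F True (\<phi> i)" "\<chi> i. F False (\<phi> i)"] sgn val by simp
qed

end

section \<open>Binary digits of the points of a parabola\<close>

text \<open>The digits of \<open>k\<close> come first, those of \<open>k\<^sup>2\<close> after them.\<close>

definition parabola_bit :: "nat \<Rightarrow> nat \<Rightarrow> nat \<Rightarrow> real" where
  "parabola_bit d k q = of_bool (if q < d then bit k q else bit (k\<^sup>2) (q - d))"

text \<open>The functional \<open>y - 2 * t * x\<close> of the point with coordinates \<open>x\<close> and \<open>y\<close> given by their binary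
  digits.\<close>

definition parabola_weight :: "nat \<Rightarrow> real \<Rightarrow> nat \<Rightarrow> real" where
  "parabola_weight d t q = (if q < d then - 2 * t * 2 ^ q else 2 ^ (q - d))"

lemma sum_bits:
  assumes "k < 2 ^ n"
  shows "(\<Sum>q<n. 2 ^ q * of_bool (bit k q)) = real k"
proof -
  have "k = (\<Sum>q<n. 2 ^ q * of_bool (bit k q))"
    using take_bit_nat_eq_self[OF assms]
    by (simp add: take_bit_sum push_bit_eq_mult atLeast0LessThan mult.commute)
  then have "real k = real (\<Sum>q<n. 2 ^ q * of_bool (bit k q))" by simp
  then show ?thesis by (simp add: of_bool_def if_distrib cong: if_cong)
qed

lemma sum_parabola_weight:
  assumes "k < 2 ^ d"
  shows "(\<Sum>q<3 * d. parabola_weight d t q * parabola_bit d k q) = (real k - t)\<^sup>2 - t\<^sup>2"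
proof -
  let ?f = "\<lambda>q. parabola_weight d t q * parabola_bit d k q"
  have "k\<^sup>2 < 2 ^ (2 * d)"
    using power_strict_mono[OF assms, of 2] by (simp add: power_mult mult.commute)
  then have hi: "(\<Sum>q<2 * d. 2 ^ q * of_bool (bit (k\<^sup>2) q)) = (real k)\<^sup>2"
    using sum_bits[of "k\<^sup>2" "2 * d"] by simp
  have "(\<Sum>q<3 * d. ?f q) = (\<Sum>q<d. ?f q) + (\<Sum>q<2 * d. ?f (q + d))"
  proof -
    have "{..<3 * d} = {..<d} \<union> {d..<3 * d}" "{..<d} \<inter> {d..<3 * d} = {}" by auto
    then have "(\<Sum>q<3 * d. ?f q) = (\<Sum>q<d. ?f q) + (\<Sum>q=d..<3 * d. ?f q)"
      by (simp add: sum.union_disjoint)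
    moreover have "(\<Sum>q=d..<3 * d. ?f q) = (\<Sum>q=0..<2 * d. ?f (q + d))"
      using sum.shift_bounds_nat_ivl[of ?f 0 d "2 * d"] by simp
    ultimately show ?thesis by (simp add: atLeast0LessThan)
  qed
  also have "(\<Sum>q<d. ?f q) = - 2 * t * (\<Sum>q<d. 2 ^ q * of_bool (bit k q))"
    unfolding sum_distrib_left by (rule sum.cong) (auto simp: parabola_weight_def parabola_bit_def)
  also have "(\<Sum>q<2 * d. ?f (q + d)) = (\<Sum>q<2 * d. 2 ^ q * of_bool (bit (k\<^sup>2) q))"
    by (rule sum.cong) (auto simp: parabola_weight_def parabola_bit_def)
  finally show ?thesis
    using sum_bits[OF assms] hi by (simp add: power2_eq_square algebra_simps)
qed

theorem theorem1p2:
  fixes d :: nat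
  assumes "d \<ge> 2" and "CARD('n::finite) = 6 * d"
  shows "\<exists>P :: (real ^ 'n) set.
    unbounded_01_polyhedron P \<and>
    combinatorial_diameter P \<ge> enat (2 ^ d - 1) \<and>
    (\<forall>R. extreme_ray_of R (recession_cone P) \<longrightarrow>
       (\<exists>g. generates_ray g R \<and> (\<forall>i. g $ i \<in> {-1, 0, 1})))"
proof -
  have "card (UNIV \<times> {..<3 * d} :: (bool \<times> nat) set) = CARD('n)"
    using assms(2) by (simp add: card_cartesian_product)
  then obtain \<phi> :: "'n \<Rightarrow> bool \<times> nat" where \<phi>: "bij_betw \<phi> UNIV (UNIV \<times> {..<3 * d})"
    using finite_same_card_bij[of "UNIV :: 'n set" "UNIV \<times> {..<3 * d} :: (bool \<times> nat) set"] by auto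
  interpret duplicated_coordinates \<phi> "3 * d" by unfold_locales (rule \<phi>)
  define N :: nat where "N = 2 ^ d"
  have N: "N \<ge> 4" using power_increasing[OF assms(1), of "2::nat"] by (simp add: N_def)
  define v where "v k = dup (parabola_bit d k)" for k
  define c where "c t = dup (parabola_weight d t)" for t
  define V where "V = v ` {..<N}"
  define S :: "(real ^ 'n) set" where "S = {g. \<forall>i. g $ i \<in> {-1, 0, 1}}"
  define G where "G = {g \<in> S. c 0 \<bullet> g > 0 \<and> c (real (N - 1)) \<bullet> g > 0}"
  define P where "P = generated_polyhedron V G"
  \<comment> \<open>the factor \<open>2\<close> comes from the two copies of each digit\<close>
  have cv: "c t \<bullet> v k = 2 * ((real k - t)\<^sup>2 - t\<^sup>2)" if "k < N" for t k
    using sum_parabola_weight[of k d t] that by (simp add: c_def v_def inner_dup_dup N_def)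
  have bin: "v k $ i \<in> {0, 1}" for k i
    by (simp add: v_def dup_nth parabola_bit_def)
  have inj: "inj_on v {..<N}"
  proof (rule inj_onI)
    fix j k assume jk: "j \<in> {..<N}" "k \<in> {..<N}" "v j = v k"
    then have "c 0 \<bullet> v j = c 0 \<bullet> v k" by (rule_tac arg_cong)
    then have "(real j)\<^sup>2 = (real k)\<^sup>2" using cv[of j 0] cv[of k 0] jk(1,2) by simp
    then show "j = k" by simp
  qed
  have finV: "finite V" by (simp add: V_def)
  have "S \<subseteq> vec_lambda ` (UNIV \<rightarrow>\<^sub>E {-1, 0, 1})"
  proof
    fix g assume "g \<in> S"
    then show "g \<in> vec_lambda ` (UNIV \<rightarrow>\<^sub>E {-1, 0, 1})"
      by (intro image_eqI[of _ _ "vec_nth g"]) (auto simp: S_def)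
  qed
  then have "finite S" by (rule finite_subset) (intro finite_imageI finite_PiE; simp)
  then have finG: "finite G" by (simp add: G_def)
  have poly: "polyhedron P" unfolding P_def using finV finG by (rule polyhedron_generated_polyhedron)
  have cone: "v j + v k - v (j + 1) - v (k - 1) \<in> convex_cone hull G"
    and pos: "c 0 \<bullet> (v j + v k - v (j + 1) - v (k - 1)) > 0" if "k < N" "j + 2 \<le> k" for j k
  proof -
    define s where "s q = parabola_bit d j q + parabola_bit d k q
      - parabola_bit d (j + 1) q - parabola_bit d (k - 1) q" for q
    have eq: "v j + v k - v (j + 1) - v (k - 1) = dup s"
      by (simp add: v_def s_def vec_eq_iff dup_nth)
    have s: "s q \<in> {-2, -1, 0, 1, 2}" for q by (simp add: s_def parabola_bit_def)
    obtain g h where gh: "dup s = g + h"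
      "\<And>i. g $ i \<in> {-1, 0, 1}" "\<And>i. h $ i \<in> {-1, 0, 1}"
      "\<And>w. dup w \<bullet> g = (\<Sum>q<3 * d. w q * s q)" "\<And>w. dup w \<bullet> h = (\<Sum>q<3 * d. w q * s q)"
      using s by (rule dup_split[of s]) blast+
    \<comment> \<open>the terms in \<open>t\<close> cancel, as \<open>j + k = (j + 1) + (k - 1)\<close>\<close>
    have val: "c t \<bullet> dup s = 4 * real (k - j - 1)" for t
    proof -
      have "real (k - 1) = real k - 1" "real (k - j - 1) = real k - real j - 1" using that by auto
      then show ?thesis
        unfolding eq[symmetric] inner_diff_right inner_add_right using that
        by (simp add: cv power2_eq_square algebra_simps)
    qed
    have half: "c t \<bullet> g = 2 * real (k - j - 1)" "c t \<bullet> h = 2 * real (k - j - 1)" for t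
      using val[of t] gh(4,5)[of "parabola_weight d t"]
      by (simp_all add: c_def inner_dup_dup)
    have "g \<in> G" "h \<in> G" using gh(2,3) half that by (auto simp: G_def S_def)
    then show "v j + v k - v (j + 1) - v (k - 1) \<in> convex_cone hull G"
      unfolding eq gh(1) by (intro convex_cone_hull_add hull_inc)
    show "c 0 \<bullet> (v j + v k - v (j + 1) - v (k - 1)) > 0"
      unfolding eq val using that by simp
  qed
  have vert: "v t \<in> vertices P" if t: "t < N" "\<And>g. g \<in> G \<Longrightarrow> c (real t) \<bullet> g > 0" for t
    unfolding vertices_def P_def mem_Collect_eq
  proof (rule unique_minimizer_extreme_point[where c = "c (real t)"])
    show "v t \<in> V" using t by (simp add: V_def)
    show "convex (generated_polyhedron V G)" using poly P_def polyhedron_imp_convex by blast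
    fix w assume "w \<in> V" "w \<noteq> v t"
    then obtain k where "k < N" "w = v k" "k \<noteq> t" by (auto simp: V_def)
    then show "c (real t) \<bullet> v t < c (real t) \<bullet> w" using t by (simp add: cv)
  qed (use t in auto)
  have v0: "v 0 \<in> vertices P" using N by (intro vert) (auto simp: G_def)
  have vN: "v (N - 1) \<in> vertices P" using N by (intro vert) (auto simp: G_def)
  have vertV: "vertices P \<subseteq> V"
    unfolding vertices_def P_def using extreme_point_of_generated_polyhedron by blast
  have "\<not> bounded P"
    unfolding P_def
  proof (rule unbounded_generated_polyhedron)
    show "V \<noteq> {}" using v0 vertV by auto
    show "v 0 + v 2 - v (0 + 1) - v (2 - 1) \<in> convex_cone hull G" using N by (intro cone) auto
    show "v 0 + v 2 - v (0 + 1) - v (2 - 1) \<noteq> 0"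
      using pos[of 2 0] N by fastforce
  qed
  then have unb: "unbounded_01_polyhedron P"
    unfolding unbounded_01_polyhedron_def using poly v0 vertV bin by (auto simp: V_def)
  have short: "k \<le> j + 1" if "j < N" "k < N" "(v j, v k) \<in> graph_edges P" for j k
    using poly that cone bin inj unfolding P_def
    by (intro chain_edge_short[of V G v N j k]) (auto simp: V_def)
  have "enat (2 ^ d - 1) \<le> graph_dist P (v 0) (v (N - 1))"
    using graph_dist_chain_ge[OF inj vertV[unfolded V_def], of "N - 1"] short N
    unfolding N_def by simp
  also have "\<dots> \<le> combinatorial_diameter P"
    unfolding combinatorial_diameter_def using v0 vN by (meson SUP_upper2 order_refl)
  finally have diam: "enat (2 ^ d - 1) \<le> combinatorial_diameter P" .
  have "\<exists>g. generates_ray g R \<and> (\<forall>i. g $ i \<in> {-1, 0, 1})" if "extreme_ray_of R (recession_cone P)" for R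
  proof -
    have "recession_cone P = convex_cone hull G"
      unfolding P_def using finV finG v0 vertV by (intro recession_cone_generated_polyhedron) auto
    then show ?thesis using extreme_ray_of_convex_cone_hull[of R G] that by (auto simp: G_def S_def)
  qed
  then show ?thesis using unb diam by blast
qed

end
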